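(* Let $d \geq 1$ and $n \geq 1$. If a set of $m$ queens is placed in the $d$-dimensional chess space of size $n$ such that every board position is attacked by at least one of the queens, then \[ m \geq \frac{2 n^{d-1}}{3^d - 1}. \] That is, the least number of queens necessary to attack all positions is no less than $\frac{2 n^{d-1}}{3^d - 1}$.
   Context: A $d$-dimensional chess space of size $n$ is the set of $n^d$ positions $\{0,1,\ldots,n-1\}^d$. A queen at position $q$ attacks a position $x$ of the board if $x = q + s\delta$ for some integer $s$ and some $\delta \in \{-1,0,1\}^d$ other than the zero vector (in particular a queen attacks the position it occupies). *)

theory Defs
  imports Complex_Main "HOL-Library.FuncSet"
begin

text \<open>A position is a function on the coordinate indices \<open>{..<d}\<close>, extended by
  \<open>undefined\<close> outside, so that distinct elements of the board are distinct points.
  Coordinates are integers because moves may go in negative directions.\<close>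

definition chess_space :: "nat \<Rightarrow> nat \<Rightarrow> (nat \<Rightarrow> int) set" where
  "chess_space d n = {..<d} \<rightarrow>\<^sub>E {0..<int n}"

definition queen_directions :: "nat \<Rightarrow> (nat \<Rightarrow> int) set" where
  "queen_directions d = {\<delta> \<in> {..<d} \<rightarrow>\<^sub>E {-1, 0, 1}. \<exists>i<d. \<delta> i \<noteq> 0}"

text \<open>The step count \<open>s\<close> may be zero, so a queen attacks its own position, and
  a queen is not blocked by other queens standing in between.\<close>

definition attacks :: "nat \<Rightarrow> (nat \<Rightarrow> int) \<Rightarrow> (nat \<Rightarrow> int) \<Rightarrow> bool" where
  "attacks d q x \<longleftrightarrow> (\<exists>s::int. \<exists>\<delta>\<in>queen_directions d. \<forall>i<d. x i = q i + s * \<delta> i)"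

definition attacks_all :: "nat \<Rightarrow> nat \<Rightarrow> (nat \<Rightarrow> int) set \<Rightarrow> bool" where
  "attacks_all d n Q \<longleftrightarrow>
     Q \<subseteq> chess_space d n \<and> (\<forall>x\<in>chess_space d n. \<exists>q\<in>Q. attacks d q x)"

text \<open>For \<open>d \<ge> 1\<close> the whole (finite) board attacks all positions, so the minimum
  below is attained.\<close>

definition min_queens :: "nat \<Rightarrow> nat \<Rightarrow> nat" where
  "min_queens d n = (LEAST m. \<exists>Q. attacks_all d n Q \<and> card Q = m)"

end

theory Submission
  imports Defs
begin

text \<open>Double counting of the triples \<open>(x, q, \<delta>)\<close> for which \<open>x\<close> lies on the line through the
  queen \<open>q\<close> in direction \<open>\<delta>\<close>. Every attacked position occurs at least twice, since
  \<open>\<delta>\<close> and \<open>-\<delta>\<close> span the same line, and each of the \<open>3 ^ d - 1\<close> lines through a queen has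
  at most \<open>n\<close> positions, so \<open>2 * n ^ d \<le> m * (3 ^ d - 1) * n\<close>.\<close>

text \<open>Only positions on the board are kept, and \<open>s\<close> runs over all integers, so
  that opposite directions give the same set.\<close>

definition queen_line :: "nat \<Rightarrow> nat \<Rightarrow> (nat \<Rightarrow> int) \<Rightarrow> (nat \<Rightarrow> int) \<Rightarrow> (nat \<Rightarrow> int) set" where
  "queen_line d n q \<delta> = {x \<in> chess_space d n. \<exists>s::int. \<forall>i<d. x i = q i + s * \<delta> i}"

lemma finite_chess_space [simp]: "finite (chess_space d n)"
  unfolding chess_space_def by (intro finite_PiE) auto

lemma card_chess_space: "card (chess_space d n) = n ^ d"
  unfolding chess_space_def by (simp add: card_PiE)

lemma finite_queen_directions [simp]: "finite (queen_directions d)"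
proof -
  have "finite ({..<d} \<rightarrow>\<^sub>E {-1, 0, 1::int})"
    by (intro finite_PiE) auto
  then show ?thesis
    unfolding queen_directions_def by simp
qed

lemma card_queen_directions: "card (queen_directions d) = 3 ^ d - 1"
proof -
  let ?F = "{..<d} \<rightarrow>\<^sub>E {-1, 0, 1::int}" and ?z = "\<lambda>i\<in>{..<d}. 0::int"
  \<comment> \<open>Extensionality fixes the values outside \<open>{..<d}\<close>, so the excluded
    zero direction is the single function \<open>?z\<close>.\<close>
  have "\<delta> = ?z \<longleftrightarrow> (\<forall>i<d. \<delta> i = 0)" if "\<delta> \<in> ?F" for \<delta>
    using that by (auto simp: PiE_def extensional_def fun_eq_iff)
  then have "queen_directions d = ?F - {?z}"
    unfolding queen_directions_def by blast
  moreover have "?z \<in> ?F"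
    by auto
  moreover have "card ?F = 3 ^ d"
    by (simp add: card_PiE numeral_3_eq_3)
  ultimately show ?thesis
    by simp
qed

text \<open>A coordinate in which \<open>\<delta>\<close> is nonzero determines the step count and
  hence the whole position, and it takes at most \<open>n\<close> values on the board.\<close>

lemma card_queen_line_le:
  assumes "\<delta> \<in> queen_directions d"
  shows "card (queen_line d n q \<delta>) \<le> n"
proof -
  obtain i where i: "i < d" "\<delta> i \<noteq> 0"
    using assms unfolding queen_directions_def by blast
  have "inj_on (\<lambda>x. x i) (queen_line d n q \<delta>)"
  proof (rule inj_onI)
    fix x y assume x: "x \<in> queen_line d n q \<delta>" and y: "y \<in> queen_line d n q \<delta>" and eq: "x i = y i"
    obtain s where s: "\<forall>j<d. x j = q j + s * \<delta> j"
      using x unfolding queen_line_def by blast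
    obtain t where t: "\<forall>j<d. y j = q j + t * \<delta> j"
      using y unfolding queen_line_def by blast
    have "s = t"
      using s t i eq by auto
    then have "x j = y j" if "j \<in> {..<d}" for j
      using s t that by simp
    moreover have "x \<in> extensional {..<d}" "y \<in> extensional {..<d}"
      using x y unfolding queen_line_def chess_space_def by (auto simp: PiE_def)
    ultimately show "x = y"
      by (metis extensionalityI)
  qed
  moreover have "(\<lambda>x. x i) ` queen_line d n q \<delta> \<subseteq> {0..<int n}"
    using i unfolding queen_line_def chess_space_def by (auto simp: PiE_iff)
  ultimately have "card (queen_line d n q \<delta>) \<le> card {0..<int n}"
    by (intro card_inj_on_le) auto
  then show ?thesis
    by simp
qed

text \<open>From \<open>x = q + s * \<delta>\<close> follows
  \<open>x = q + (-s) * (-\<delta>)\<close>, and \<open>\<delta>\<close> differs from its negative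
  because it is nonzero. This also covers \<open>s = 0\<close>, where \<open>x\<close> is the
  position of the queen.\<close>

lemma two_le_card_attack_directions:
  assumes "x \<in> chess_space d n" "attacks d q x"
  shows "2 \<le> card {\<delta> \<in> queen_directions d. x \<in> queen_line d n q \<delta>}"
proof -
  obtain s \<delta> where \<delta>: "\<delta> \<in> queen_directions d" and s: "\<forall>i<d. x i = q i + s * \<delta> i"
    using assms(2) unfolding attacks_def by blast
  obtain i where i: "i < d" "\<delta> i \<noteq> 0"
    using \<delta> unfolding queen_directions_def by blast
  \<comment> \<open>The negation is restricted to \<open>{..<d}\<close> because directions must be
    extensional.\<close>
  let ?\<delta>' = "\<lambda>i\<in>{..<d}. - \<delta> i"
  have "- \<delta> j \<in> {-1, 0, 1}" if "j \<in> {..<d}" for j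
  proof -
    have "\<delta> j \<in> {-1, 0, 1}"
      using \<delta> that unfolding queen_directions_def by (blast dest: PiE_mem)
    then show ?thesis
      by auto
  qed
  then have "?\<delta>' \<in> {..<d} \<rightarrow>\<^sub>E {-1, 0, 1}"
    by (rule restrict_PiE_iff[THEN iffD2, rule_format])
  moreover have "\<exists>i<d. ?\<delta>' i \<noteq> 0"
    using i by auto
  ultimately have "?\<delta>' \<in> queen_directions d"
    unfolding queen_directions_def by blast
  moreover have "\<forall>j<d. x j = q j + (- s) * ?\<delta>' j"
    using s by simp
  ultimately have "{\<delta>, ?\<delta>'} \<subseteq> {\<delta> \<in> queen_directions d. x \<in> queen_line d n q \<delta>}"
    using \<delta> s assms(1) unfolding queen_line_def by blast
  then have "card {\<delta>, ?\<delta>'} \<le> card {\<delta> \<in> queen_directions d. x \<in> queen_line d n q \<delta>}"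
    by (intro card_mono) auto
  moreover have "\<delta> \<noteq> ?\<delta>'"
  proof
    assume "\<delta> = ?\<delta>'"
    then have "\<delta> i = ?\<delta>' i"
      by (rule fun_cong)
    then show False
      using i by simp
  qed
  ultimately show ?thesis
    by simp
qed

lemma attacks_all_double_count:
  assumes "attacks_all d n Q"
  shows "2 * n ^ d \<le> card Q * (3 ^ d - 1) * n"
proof -
  let ?B = "chess_space d n" and ?D = "queen_directions d"
  let ?dirs = "\<lambda>x q. {\<delta> \<in> ?D. x \<in> queen_line d n q \<delta>}"
  have Q: "Q \<subseteq> ?B" and att: "\<And>x. x \<in> ?B \<Longrightarrow> \<exists>q\<in>Q. attacks d q x"
    using assms unfolding attacks_all_def by auto
  have fin: "finite Q"
    using Q finite_chess_space by (rule finite_subset)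
  have "2 \<le> (\<Sum>q\<in>Q. card (?dirs x q))" if x: "x \<in> ?B" for x
  proof -
    obtain q where q: "q \<in> Q" "attacks d q x"
      using att x by blast
    have "2 \<le> card (?dirs x q)"
      using x q(2) by (rule two_le_card_attack_directions)
    also have "\<dots> \<le> (\<Sum>q\<in>Q. card (?dirs x q))"
      using q(1) fin by (intro member_le_sum) auto
    finally show ?thesis .
  qed
  then have "(\<Sum>x\<in>?B. 2) \<le> (\<Sum>x\<in>?B. \<Sum>q\<in>Q. card (?dirs x q))"
    by (rule sum_mono)
  also have "\<dots> = (\<Sum>q\<in>Q. \<Sum>x\<in>?B. card (?dirs x q))"
    by (rule sum.swap)
  \<comment> \<open>For a fixed queen, the incident pairs of a position and a direction are counted
    first by position, then by direction.\<close>
  also have "\<dots> = (\<Sum>q\<in>Q. \<Sum>\<delta>\<in>?D. card (queen_line d n q \<delta>))"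
  proof (rule sum.cong[OF refl])
    fix q
    have "{x \<in> ?B. x \<in> queen_line d n q \<delta>} = queen_line d n q \<delta>" for \<delta>
      unfolding queen_line_def by blast
    then show "(\<Sum>x\<in>?B. card (?dirs x q)) = (\<Sum>\<delta>\<in>?D. card (queen_line d n q \<delta>))"
      using sum_multicount_gen[of ?B ?D "\<lambda>x \<delta>. x \<in> queen_line d n q \<delta>"
          "\<lambda>\<delta>. card (queen_line d n q \<delta>)"] by simp
  qed
  also have "\<dots> \<le> (\<Sum>q\<in>Q. \<Sum>\<delta>\<in>?D. n)"
    by (intro sum_mono card_queen_line_le)
  finally show ?thesis
    by (simp add: card_chess_space card_queen_directions mult_ac)
qed

text \<open>One factor \<open>n\<close> cancels from the double count, as \<open>n\<close> is
  positive; \<open>d \<ge> 1\<close> allows the split of \<open>n ^ d\<close> and makes the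
  denominator positive.\<close>

lemma card_attacking_queens_ge:
  assumes "d \<ge> 1" "n \<ge> 1" "attacks_all d n Q"
  shows "real (card Q) \<ge> 2 * real n ^ (d - 1) / (3 ^ d - 1)"
proof -
  have "n ^ d = n ^ (d - 1) * n"
    using assms(1) by (simp add: power_eq_if)
  then have "2 * n ^ (d - 1) * n \<le> card Q * (3 ^ d - 1) * n"
    using attacks_all_double_count[OF assms(3)] by simp
  then have "2 * n ^ (d - 1) \<le> card Q * (3 ^ d - 1)"
    using assms(2) by simp
  then have "real (2 * n ^ (d - 1)) \<le> real (card Q * (3 ^ d - 1))"
    by (rule of_nat_mono)
  \<comment> \<open>The truncated subtraction on naturals agrees with the real one since
    \<open>1 \<le> 3 ^ d\<close>.\<close>
  then have "2 * real n ^ (d - 1) \<le> real (card Q) * (3 ^ d - 1)"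
    by (simp add: of_nat_diff)
  moreover have "(3::real) ^ d - 1 > 0"
    using assms(1) by simp
  ultimately show ?thesis
    by (simp add: divide_le_eq)
qed

text \<open>Guarantees that the \<open>LEAST\<close> in \<open>min_queens\<close> ranges over a
  nonempty set. Each position attacks itself with step count 0 along the all-ones direction.\<close>

lemma attacks_all_chess_space:
  assumes "d \<ge> 1"
  shows "attacks_all d n (chess_space d n)"
proof -
  have "(\<lambda>i\<in>{..<d}. 1) \<in> queen_directions d"
    using assms unfolding queen_directions_def by (auto intro!: exI[of _ 0])
  then have "attacks d x x" for x
    unfolding attacks_def by (intro exI[of _ 0] bexI) auto
  then show ?thesis
    unfolding attacks_all_def by blast
qed

theorem theorem2:
  fixes d n :: nat
  assumes "d \<ge> 1" and "n \<ge> 1"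
  shows "(\<forall>Q. attacks_all d n Q \<longrightarrow> real (card Q) \<ge> 2 * real n ^ (d - 1) / (3 ^ d - 1)) \<and>
         real (min_queens d n) \<ge> 2 * real n ^ (d - 1) / (3 ^ d - 1)"
proof -
  \<comment> \<open>The minimum is attained by an actual set of queens, to which the general bound
    applies.\<close>
  have "\<exists>Q. attacks_all d n Q \<and> card Q = min_queens d n"
    unfolding min_queens_def
    by (rule LeastI_ex) (use attacks_all_chess_space[OF assms(1)] in blast)
  then show ?thesis
    using card_attacking_queens_ge[OF assms] by metis
qed

end
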